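(* Let $G$ be a finite multigraph on the vertex set $[n]$ (multiple edges and loops allowed) and let $d\geq 1$ be an integer. Then the multivariate $d$-matching polynomial $\mu_{d,G}(\mathbf{x})$, a polynomial in the $nd$ variables $x_{v k}$ ($v\in[n]$, $1\le k\le d$), is stable.
   Context: A polynomial $f\in\mathbb{C}[y_1,\dots,y_m]$ is stable if $f(y_1,\dots,y_m)\neq 0$ whenever $\mathrm{Im}(y_j)>0$ for all $j$ (the zero polynomial is also regarded as stable). Each undirected edge (including each loop) of $G$ is viewed as a pair of oriented edges $e,-e$ of opposite orientation; $E^+(G)$ denotes a choice of one orientation per undirected edge, and $h(e),t(e)$ are the head and tail of $e$. A $d$-covering of $G$ is a map $\sigma:E(G)\to S_d$ with $\sigma(-e)=\sigma(e)^{-1}$, writing $\sigma_e=\sigma(e)$. It determines the covering graph $H$ with vertex set $\{v_k: v\in[n],1\le k\le d\}$ in which, for each $e\in E^+(G)$ and each $1\le k\le d$, there is an undirected edge joining $h(e)_k$ and $t(e)_{\sigma_e(k)}$ (for a loop $e$ at $v$ and a fixed point $k$ of $\sigma_e$ this is a loop at $v_k$). Let $\mathcal{C}_{d,G}$ be the set of all $d$-coverings with the uniform distribution. For a multigraph $H$ with vertex set $V$, a matching is a set $M$ of non-loop edges no two of which share a vertex, $V(M)$ is the set of vertices covered by $M$, and the multivariate matching polynomial is $\mu_H(\mathbf{x})=\sum_M (-1)^{|M|}\prod_{u\in V\setminus V(M)} x_u$, the sum over all matchings of $H$ (for a covering graph, $x_{v_k}$ is written $x_{vk}$). The multivariate $d$-matching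 polynomial is $\mu_{d,G}(\mathbf{x})=\mathbb{E}_{H\in\mathcal{C}_{d,G}}\mu_H(\mathbf{x})$, the uniform average over all $d$-coverings of the multivariate matching polynomials of the corresponding covering graphs. *)

theory Defs
  imports
    Complex_Main
    "HOL-Library.FuncSet"
    "HOL-Library.Poly_Mapping"
    "HOL-Library.Uprod"
    "HOL-Combinatorics.Permutations"
    "Graph_Theory.Digraph"
    "Graph_Theory.Bidirected_Digraph"
begin

text \<open>Multivariate complex polynomials: finitely supported maps from monomials (exponent
  vectors, themselves finitely supported) to coefficients, with the convolution product of
  \<^theory>\<open>HOL-Library.Poly_Mapping\<close>.\<close>

type_synonym 'v cpoly = "('v \<Rightarrow>\<^sub>0 nat) \<Rightarrow>\<^sub>0 complex"

definition const_poly :: "complex \<Rightarrow> 'v cpoly" where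
  "const_poly c = Poly_Mapping.single 0 c"

definition var_poly :: "'v \<Rightarrow> 'v cpoly" where
  "var_poly v = Poly_Mapping.single (Poly_Mapping.single v 1) 1"

definition eval_poly :: "'v cpoly \<Rightarrow> ('v \<Rightarrow> complex) \<Rightarrow> complex" where
  "eval_poly f y =
     (\<Sum>m\<in>Poly_Mapping.keys f. Poly_Mapping.lookup f m *
        (\<Prod>v\<in>Poly_Mapping.keys m. y v ^ Poly_Mapping.lookup m v))"

definition poly_vars :: "'v cpoly \<Rightarrow> 'v set" where
  "poly_vars f = (\<Union>m\<in>Poly_Mapping.keys f. Poly_Mapping.keys m)"

definition stable_poly :: "'v set \<Rightarrow> 'v cpoly \<Rightarrow> bool" where
  "stable_poly I f \<longleftrightarrow>
     f = 0 \<or> (\<forall>y. (\<forall>j\<in>I. Im (y j) > 0) \<longrightarrow> eval_poly f y \<noteq> 0)"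

text \<open>Undirected multigraphs: every edge has an unordered pair of end vertices, which
  coincide for a loop.\<close>

record ('v, 'e) multigraph =
  mg_verts :: "'v set"
  mg_edges :: "'e set"
  mg_ends :: "'e \<Rightarrow> 'v uprod"

definition matchings :: "('v, 'e) multigraph \<Rightarrow> 'e set set" where
  "matchings H = {M. M \<subseteq> mg_edges H \<and>
     (\<forall>e\<in>M. proper_uprod (mg_ends H e)) \<and>
     (\<forall>e\<in>M. \<forall>f\<in>M. e \<noteq> f \<longrightarrow> set_uprod (mg_ends H e) \<inter> set_uprod (mg_ends H f) = {})}"

definition covered_verts :: "('v, 'e) multigraph \<Rightarrow> 'e set \<Rightarrow> 'v set" where
  "covered_verts H M = (\<Union>e\<in>M. set_uprod (mg_ends H e))"

definition matching_poly :: "('v, 'e) multigraph \<Rightarrow> 'v cpoly" where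
  "matching_poly H =
     (\<Sum>M\<in>matchings H. (- 1) ^ card M * (\<Prod>u\<in>mg_verts H - covered_verts H M. var_poly u))"

text \<open>The base graph is given by its oriented edges: a \<^locale>\<open>bidirected_digraph\<close>, in which
  \<open>arev\<close> is the orientation reversal \<open>e \<mapsto> -e\<close>. It has no fixed points on the arcs, so
  a loop also contributes two oriented edges, and parallel arcs are allowed.
  \<open>is_orientation\<close> says that \<open>Ep\<close> is a valid \<open>E\<^sup>+\<close>.\<close>

definition is_orientation :: "('v, 'e) pre_digraph \<Rightarrow> ('e \<Rightarrow> 'e) \<Rightarrow> 'e set \<Rightarrow> bool" where
  "is_orientation G arev Ep \<longleftrightarrow> Ep \<union> arev ` Ep = arcs G \<and> Ep \<inter> arev ` Ep = {}"

text \<open>Coverings are functions on the oriented edges only: \<open>\<rightarrow>\<^sub>E\<close> fixes the value outside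
  \<^term>\<open>arcs G\<close>, so that each covering is counted once in the average.\<close>

definition coverings ::
    "nat \<Rightarrow> ('v, 'e) pre_digraph \<Rightarrow> ('e \<Rightarrow> 'e) \<Rightarrow> ('e \<Rightarrow> nat \<Rightarrow> nat) set" where
  "coverings d G arev =
     {\<sigma> \<in> arcs G \<rightarrow>\<^sub>E {p. p permutes {1..d}}. \<forall>e\<in>arcs G. \<sigma> (arev e) = inv (\<sigma> e)}"

definition covering_graph ::
    "nat \<Rightarrow> ('v, 'e) pre_digraph \<Rightarrow> 'e set \<Rightarrow> ('e \<Rightarrow> nat \<Rightarrow> nat) \<Rightarrow>
     ('v \<times> nat, 'e \<times> nat) multigraph" where
  "covering_graph d G Ep \<sigma> =
     \<lparr>mg_verts = verts G \<times> {1..d},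
      mg_edges = Ep \<times> {1..d},
      mg_ends = (\<lambda>(e, k). Upair (head G e, k) (tail G e, \<sigma> e k))\<rparr>"

definition d_matching_poly ::
    "nat \<Rightarrow> ('v, 'e) pre_digraph \<Rightarrow> ('e \<Rightarrow> 'e) \<Rightarrow> 'e set \<Rightarrow> ('v \<times> nat) cpoly" where
  "d_matching_poly d G arev Ep =
     const_poly (1 / of_nat (card (coverings d G arev))) *
       (\<Sum>\<sigma>\<in>coverings d G arev. matching_poly (covering_graph d G Ep \<sigma>))"

end

theory Submission
  imports Defs
begin

text \<open>The permutations attached to different edges are independent. Give each half-edge (an end of
  one of the \<open>d\<close> lifts of an edge) its own auxiliary variable. The product over all edges of
  \<open>\<Sum>\<sigma>. \<Prod>k. (1 - a k * b (\<sigma> k))\<close> does not vanish on the upper half-plane: each factor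
  \<open>1 - a k * b k\<close> is stable, averaging a multiaffine stable polynomial over a random variable swap
  preserves stability, and the uniform permutation is a product of independent random swaps.
  Replacing every half-edge variable by \<open>-\<partial>/\<partial>x\<close>, where \<open>x\<close> belongs to the vertex at which
  the half-edge ends, preserves stability by the Lieb-Sokal argument and turns the product into an
  operator whose value at \<open>\<Prod>u. x u\<close> is the sum of the matching polynomials of all coverings: a
  monomial survives exactly when its half-edges end at distinct vertices, that is, when it comes
  from a matching. In particular, lifts of a loop that are loops drop out.\<close>

section \<open>Bilinear polynomials on the upper half-plane\<close>

text \<open>Otherwise x = -u lies in the upper half-plane. Setting y + v = i t and solving for x
  gives x = K / (i t) - u, which tends to -u, so a large t yields a zero with both variables in the
  half-plane.\<close>

lemma Im_pole_nonneg:
  fixes u v K :: complex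
  assumes nz: "\<And>x y. Im x > 0 \<Longrightarrow> Im y > 0 \<Longrightarrow> (x + u) * (y + v) \<noteq> K"
  shows "Im u \<ge> 0"
proof (rule ccontr)
  assume "\<not> 0 \<le> Im u"
  hence a: "Im u < 0" by simp
  \<comment> \<open>The bounds keep t positive, put \<open>w - v\<close> into the half-plane and
    make \<bar>Re K\<bar> / t smaller than - Im u.\<close>
  define t where "t = max 1 (max (Im v + 1) (\<bar>Re K\<bar> / (- Im u) + 1))"
  have t: "t \<ge> 1" "t > Im v" "t > \<bar>Re K\<bar> / (- Im u)" by (auto simp: t_def)
  define w where "w = \<i> * of_real t"
  have w: "w \<noteq> 0" "Im w = t" using t by (auto simp: w_def)
  have "Im (K / w) = - Re K / t"
    using t by (simp add: w_def Im_divide power2_eq_square)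
  moreover have "\<bar>Re K\<bar> < t * (- Im u)"
    using t(3) a pos_divide_less_eq[of "- Im u" "\<bar>Re K\<bar>" t] by simp
  hence "Im u < - Re K / t" using t(1) by (simp add: field_simps)
  ultimately have "Im (K / w - u) > 0" by simp
  moreover have "Im (w - v) > 0" using w t by simp
  ultimately have "(K / w - u + u) * (w - v + v) \<noteq> K" by (rule nz)
  thus False using w by simp
qed

text \<open>For K = k^2, \<open>cmod K - Re K\<close> equals 2 (Im k)^2. Above the bound, some real
  r > 0 makes r k and k / r, whose product is K, have imaginary parts exceeding Im u and Im v;
  subtracting u and v gives a forbidden zero.\<close>

lemma bilinear_nonvanishingD:
  fixes u v K :: complex
  assumes nz: "\<And>x y. Im x > 0 \<Longrightarrow> Im y > 0 \<Longrightarrow> (x + u) * (y + v) \<noteq> K"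
  shows "cmod K - Re K \<le> 2 * Im u * Im v"
proof (rule ccontr)
  have a: "Im u \<ge> 0" by (rule Im_pole_nonneg[OF nz])
  have b: "Im v \<ge> 0"
    by (rule Im_pole_nonneg[where v = u and K = K]) (metis nz mult.commute)
  assume "\<not> ?thesis"
  hence K: "cmod K - Re K > 2 * (Im u * Im v)" by simp
  obtain k where k: "k\<^sup>2 = K" "Im k \<ge> 0"
  proof (cases "Im (csqrt K) \<ge> 0")
    case True thus ?thesis using that[of "csqrt K"] by simp
  next
    case False thus ?thesis using that[of "- csqrt K"] by simp
  qed
  have "cmod K - Re K = 2 * (Im k)\<^sup>2"
    unfolding k(1)[symmetric] norm_power cmod_power2 by (simp add: power2_eq_square)
  hence m: "(Im k)\<^sup>2 > Im u * Im v" using K by simp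
  have mpos: "Im k > 0"
  proof (rule ccontr)
    assume "\<not> Im k > 0"
    hence "Im k = 0" using k by simp
    moreover have "0 \<le> Im u * Im v" using a b by simp
    ultimately show False using m by simp
  qed
  have "Im u / Im k * Im v < Im k" using m mpos by (simp add: field_simps power2_eq_square)
  \<comment> \<open>The admissible r form the interval between Im u / Im k and Im k / Im v,
    unbounded above if Im v = 0.\<close>
  then obtain r where r: "r > Im u / Im k" "r * Im v < Im k"
  proof (cases "Im v = 0")
    case True thus ?thesis using that[of "Im u / Im k + 1"] mpos by simp
  next
    case False
    hence "Im u / Im k < Im k / Im v"
      using b \<open>Im u / Im k * Im v < Im k\<close> by (simp add: pos_less_divide_eq)
    then obtain r where "Im u / Im k < r" "r < Im k / Im v" using dense by blast
    thus ?thesis using that[of r] b False by (simp add: pos_less_divide_eq)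
  qed
  have "Im u / Im k \<ge> 0" using a mpos by simp
  hence rpos: "r > 0" using r by linarith
  have "Im (of_real r * k - u) > 0" using r(1) mpos by (simp add: field_simps)
  moreover have "Im (k / of_real r - v) > 0" using r(2) rpos by (simp add: field_simps)
  ultimately have "(of_real r * k - u + u) * (k / of_real r - v + v) \<noteq> K" by (rule nz)
  thus False using rpos k(1) by (simp add: power2_eq_square)
qed

text \<open>Converse criterion: if z w = K, then Re (z * cnj w) \<le> cmod K reads 2 Im z Im w \<le>
  \<open>cmod K - Re K\<close>, while z = x + u and w = y + v satisfy Im z Im w > Im u Im v.\<close>

lemma bilinear_nonvanishingI:
  fixes u v K :: complex
  assumes ab: "Im u \<ge> 0" "Im v \<ge> 0" and K: "cmod K - Re K \<le> 2 * Im u * Im v"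
    and xy: "Im x > 0" "Im y > 0"
  shows "(x + u) * (y + v) \<noteq> K"
proof
  define z w where "z = x + u" and "w = y + v"
  assume eq: "(x + u) * (y + v) = K"
  have "Re z * Re w + Im z * Im w = Re (z * cnj w)" by simp
  also have "\<dots> \<le> cmod (z * cnj w)" by (rule complex_Re_le_cmod)
  also have "\<dots> = cmod (z * w)" by (simp only: norm_mult complex_mod_cnj)
  also have "z * w = K" using eq by (simp add: z_def w_def)
  finally have "cmod K - Re K \<ge> 2 * (Im z * Im w)"
    using eq by (auto simp: z_def w_def)
  moreover have "Im u * Im v < Im z * Im w"
    using ab xy by (intro mult_strict_mono') (auto simp: z_def w_def)
  ultimately show False using K by simp
qed

text \<open>Averaging with the swapped polynomial changes \<open>K\<close> by \<open>p * (1 - p) * (u - v)\<^sup>2\<close>. The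
  criterion survives because \<open>\<lambda>z. cmod z - Re z\<close> is subadditive and takes the value
  \<open>2 * (Im u - Im v)\<^sup>2\<close> at \<open>(u - v)\<^sup>2\<close>.\<close>

lemma bilinear_swap_average_nonzero:
  fixes A B C D x y :: complex and p :: real
  defines "f \<equiv> \<lambda>x y. A + B * x + C * y + D * x * y"
  assumes nz: "\<And>x y. Im x > 0 \<Longrightarrow> Im y > 0 \<Longrightarrow> f x y \<noteq> 0"
    and p: "0 \<le> p" "p \<le> 1" and xy: "Im x > 0" "Im y > 0"
  shows "of_real p * f x y + of_real (1 - p) * f y x \<noteq> 0"
proof (cases "D = 0")
  case True
  define q where "q = 1 - p"
  have q: "q \<ge> 0" "p + q = 1" using p by (auto simp: q_def)
  have pos: "p * Im s + q * Im t > 0" if "Im s > 0" "Im t > 0" for s t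
    using that q p
    by (metis add_nonneg_pos add_pos_nonneg less_eq_real_def mult_nonneg_nonneg mult_pos_pos
        add_cancel_right_left zero_neq_one)
  \<comment> \<open>Without the mixed term, averaging values amounts to evaluating at averaged
    arguments, which stay in the convex half-plane.\<close>
  have "f (of_real p * x + of_real q * y) (of_real p * y + of_real q * x) \<noteq> 0"
    using pos[of x y] pos[of y x] xy by (intro nz) auto
  moreover have "of_real p * f x y + of_real q * f y x
      = of_real (p + q) * A + B * (of_real p * x + of_real q * y) + C * (of_real p * y + of_real q * x)"
    by (simp add: f_def True algebra_simps)
  ultimately show ?thesis using q True by (simp add: f_def q_def[symmetric])
next
  case False
  define q where "q = 1 - p"
  have q: "q \<ge> 0" "p + q = 1" using p by (auto simp: q_def)
  \<comment> \<open>Completing the product gives f = D ((x + u)(y + v) - K), the form to which the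
    criterion applies.\<close>
  define u v where "u = C / D" and "v = B / D"
  define K where "K = u * v - A / D"
  have f_eq: "f s t = D * ((s + u) * (t + v) - K)" for s t
    using False by (simp add: f_def u_def v_def K_def field_simps)
  have nz': "(s + u) * (t + v) \<noteq> K" if "Im s > 0" "Im t > 0" for s t
    using nz[OF that] by (simp add: f_eq)
  have a: "Im u \<ge> 0" by (rule Im_pole_nonneg[OF nz'])
  have b: "Im v \<ge> 0"
    by (rule Im_pole_nonneg[where v = u and K = K]) (metis nz' mult.commute)
  have NK: "cmod K - Re K \<le> 2 * Im u * Im v" by (rule bilinear_nonvanishingD[OF nz'])
  define u' v' where "u' = of_real p * u + of_real q * v" and "v' = of_real p * v + of_real q * u"
  define E where "E = of_real (p * q) * (u - v)\<^sup>2"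
  have pq: "of_real p = 1 - (of_real q :: complex)" using q
    by (metis add_diff_cancel_right' of_real_1 of_real_diff)
  have "cmod E = (p * q) * (cmod (u - v))\<^sup>2"
    using p q by (simp add: E_def norm_mult norm_power)
  hence NE: "cmod E - Re E = 2 * (p * q * (Im u - Im v)\<^sup>2)"
    unfolding cmod_power2 by (simp add: E_def power2_eq_square algebra_simps)
  \<comment> \<open>The product of the imaginary parts of the shifts grows by exactly half of
    \<open>cmod E - Re E\<close>, which pays for replacing K by K + E.\<close>
  have Im': "Im u' * Im v' = Im u * Im v + p * q * (Im u - Im v)\<^sup>2"
  proof -
    have "p = 1 - q" using q by simp
    show ?thesis
      unfolding u'_def v'_def \<open>p = 1 - q\<close> by (simp add: power2_eq_square algebra_simps)
  qed
  have "cmod (K + E) \<le> cmod K + cmod E" by (rule norm_triangle_ineq)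
  hence "cmod (K + E) - Re (K + E) \<le> 2 * (Im u' * Im v')"
    using NK NE Im' by (simp add: algebra_simps)
  moreover have "Im u' \<ge> 0" "Im v' \<ge> 0" using a b p q by (auto simp: u'_def v'_def)
  ultimately have "(x + u') * (y + v') \<noteq> K + E"
    using xy by (intro bilinear_nonvanishingI) auto
  moreover have "of_real p * f x y + of_real q * f y x = D * ((x + u') * (y + v') - (K + E))"
    unfolding f_eq by (simp add: pq u'_def v'_def E_def power2_eq_square algebra_simps)
  ultimately show ?thesis using False by (simp add: q_def[symmetric])
qed

text \<open>Including \<open>0\<close> rules out that a polynomial degenerates to zero when an auxiliary variable
  is eliminated, so that no limit argument in the style of Hurwitz is needed.\<close>

definition uhp0 :: "complex set" where "uhp0 = insert 0 {z. Im z > 0}"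

lemma affine_nonvanishingD:
  fixes c :: complex
  assumes "\<And>y. Im y > 0 \<Longrightarrow> 1 + c * y \<noteq> 0"
  shows "Im c \<le> 0"
proof (rule ccontr)
  assume *: "\<not> ?thesis"
  hence "Im (- 1 / c) > 0" by (simp add: Im_divide sum_power2_gt_zero_iff)
  from assms[OF this] show False using * by (cases "c = 0") auto
qed

text \<open>After division by A, nonvanishing on \<open>uhp0\<close> says that the linear
  coefficient has nonpositive imaginary part, a convex condition.\<close>

lemma affine_nonvanishing_convex:
  fixes A B C y :: complex and p :: real
  assumes B: "\<And>y. y \<in> uhp0 \<Longrightarrow> A + B * y \<noteq> 0" and C: "\<And>y. y \<in> uhp0 \<Longrightarrow> A + C * y \<noteq> 0"
    and p: "0 \<le> p" "p \<le> 1" and y: "y \<in> uhp0"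
  shows "of_real p * (A + B * y) + of_real (1 - p) * (A + C * y) \<noteq> 0"
proof
  have A: "A \<noteq> 0" using B[of 0] by (simp add: uhp0_def)
  have b: "Im (B / A) \<le> 0"
    using B A by (intro affine_nonvanishingD) (auto simp: uhp0_def field_simps)
  have c: "Im (C / A) \<le> 0"
    using C A by (intro affine_nonvanishingD) (auto simp: uhp0_def field_simps)
  define B' C' where "B' = B / A" and "C' = C / A"
  have BC: "B = A * B'" "C = A * C'" using A by (simp_all add: B'_def C'_def)
  define k where "k = of_real p * B' + of_real (1 - p) * C'"
  have "Im k = p * Im B' + (1 - p) * Im C'" by (simp add: k_def)
  hence k: "Im k \<le> 0"
    using b c p unfolding B'_def[symmetric] C'_def[symmetric]
    by (auto intro!: add_nonpos_nonpos mult_nonneg_nonpos)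
  assume "of_real p * (A + B * y) + of_real (1 - p) * (A + C * y) = 0"
  hence "A * (1 + k * y) = 0" by (simp add: k_def BC algebra_simps)
  hence e: "k * y = - 1" using A by (simp add: add_eq_0_iff)
  hence "y \<noteq> 0" by auto
  hence yI: "Im y > 0" using y by (simp add: uhp0_def)
  define r where "r = (cmod y)\<^sup>2"
  \<comment> \<open>Multiplying k y = -1 by \<open>cnj y\<close> gives k r = - cnj y, with positive
    imaginary part, against Im k \<le> 0.\<close>
  have "k * of_real r = (k * y) * cnj y"
    unfolding r_def by (simp only: complex_norm_square mult.assoc)
  hence "Im (k * of_real r) = Im y" using e by simp
  hence "Im k * r = Im y" by simp
  moreover have "Im k * r \<le> 0" using k by (intro mult_nonpos_nonneg) (auto simp: r_def)
  ultimately show False using yI by simp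
qed

text \<open>When one variable is 0, the two argument orders leave affine polynomials with a common
  constant term, so convexity applies.\<close>

lemma bilinear_swap_average_nonzero0:
  fixes A B C D x y :: complex and p :: real
  defines "f \<equiv> \<lambda>x y. A + B * x + C * y + D * x * y"
  assumes nz: "\<And>x y. x \<in> uhp0 \<Longrightarrow> y \<in> uhp0 \<Longrightarrow> f x y \<noteq> 0"
    and p: "0 \<le> p" "p \<le> 1" and xy: "x \<in> uhp0" "y \<in> uhp0"
  shows "of_real p * f x y + of_real (1 - p) * f y x \<noteq> 0"
proof -
  have B: "A + B * t \<noteq> 0" and C: "A + C * t \<noteq> 0" if "t \<in> uhp0" for t
    using nz[of t 0] nz[of 0 t] that by (auto simp: f_def uhp0_def)
  consider "x = 0" | "y = 0" | "Im x > 0" "Im y > 0" using xy by (auto simp: uhp0_def)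
  thus ?thesis
  proof cases
    case 1
    thus ?thesis using affine_nonvanishing_convex[OF C B p xy(2)] by (simp add: f_def)
  next
    case 2
    thus ?thesis using affine_nonvanishing_convex[OF B C p xy(1)] by (simp add: f_def)
  next
    case 3
    thus ?thesis unfolding f_def
      using p nz by (intro bilinear_swap_average_nonzero) (auto simp: f_def uhp0_def)
  qed
qed

text \<open>Write the polynomial as P + t Q with Q = \<gamma> + \<delta> z. At t = -Q'/Q = -1 / (z +
  u) the term t Q becomes -\<delta>. The zero -u of Q is outside the open upper half-plane, so z + u
  is inside, and hence t is too.\<close>

lemma lieb_sokal_bilinear:
  fixes \<alpha> \<beta> \<gamma> \<delta> z :: complex
  assumes nz: "\<And>z t. Im z > 0 \<Longrightarrow> t \<in> uhp0 \<Longrightarrow> \<alpha> + \<beta> * z + \<gamma> * t + \<delta> * z * t \<noteq> 0"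
    and z: "Im z > 0"
  shows "\<alpha> + \<beta> * z - \<delta> \<noteq> 0"
proof (cases "\<delta> = 0")
  case True
  thus ?thesis using nz[OF z, of 0] by (simp add: uhp0_def)
next
  case False
  define u where "u = \<gamma> / \<delta>"
  have "Im u \<ge> 0"
  proof (rule Im_pole_nonneg)
    fix x y :: complex assume "Im x > 0" "Im y > 0"
    hence "\<alpha> + \<beta> * x + \<gamma> * y + \<delta> * x * y \<noteq> 0" by (intro nz) (auto simp: uhp0_def)
    moreover have "\<alpha> + \<beta> * x + \<gamma> * y + \<delta> * x * y
        = \<delta> * ((x + u) * (y + \<beta> / \<delta>) - (u * \<beta> / \<delta> - \<alpha> / \<delta>))"
      using False by (simp add: u_def field_simps)
    ultimately show "(x + u) * (y + \<beta> / \<delta>) \<noteq> u * \<beta> / \<delta> - \<alpha> / \<delta>" by auto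
  qed
  hence I: "Im (z + u) > 0" using z by simp
  hence "z + u \<noteq> 0" by (metis less_irrefl zero_complex.sel(2))
  define s where "s = z + u"
  have "Im s > 0" using I by (simp only: s_def)
  hence "Im (- 1 / s) > 0" by (simp add: Im_divide sum_power2_gt_zero_iff)
  hence "Im (- 1 / (z + u)) > 0" by (simp only: s_def)
  hence "- 1 / (z + u) \<in> uhp0" by (simp add: uhp0_def)
  from nz[OF z this] have "\<alpha> + \<beta> * z + \<delta> * (z + u) * (- 1 / (z + u)) \<noteq> 0"
    using False by (simp add: u_def algebra_simps add_divide_distrib)
  thus ?thesis using \<open>z + u \<noteq> 0\<close> by simp
qed


section \<open>Symmetrisation of multiaffine functions\<close>

definition multiaffine :: "(('a \<Rightarrow> complex) \<Rightarrow> complex) \<Rightarrow> bool" where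
  "multiaffine f \<longleftrightarrow> (\<forall>b i. \<exists>\<alpha> \<beta>. \<forall>x. f (b(i := x)) = \<alpha> + \<beta> * x)"

definition nonvanishing0 :: "(('a \<Rightarrow> complex) \<Rightarrow> complex) \<Rightarrow> bool" where
  "nonvanishing0 f \<longleftrightarrow> (\<forall>b. (\<forall>i. b i \<in> uhp0) \<longrightarrow> f b \<noteq> 0)"

lemma multiaffine_bilinear:
  assumes f: "multiaffine f" and ij: "i \<noteq> j"
  obtains A B C D where "\<And>x y. f (b(i := x, j := y)) = A + B * x + C * y + D * x * y"
proof -
  \<comment> \<open>Reading the coefficients off the values at 0 and 1 makes them explicit functions
    of the other coordinates.\<close>
  have aff: "f (c(k := x)) = f (c(k := 0)) + (f (c(k := 1)) - f (c(k := 0))) * x" for c k x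
  proof -
    obtain \<alpha> \<beta> where "\<And>x. f (c(k := x)) = \<alpha> + \<beta> * x"
      using f unfolding multiaffine_def by meson
    thus ?thesis by simp
  qed
  define h where "h s t = f (b(j := s, i := t))" for s t
  define \<alpha> \<beta> where "\<alpha> s = h s 0" and "\<beta> s = h s 1 - h s 0" for s
  have h: "h s x = \<alpha> s + \<beta> s * x" for s x
    unfolding h_def \<alpha>_def \<beta>_def by (rule aff)
  have "f (b(i := x, j := y)) = h 0 x + (h 1 x - h 0 x) * y" for x y
    using aff[of "b(i := x)" j y] ij by (simp add: h_def fun_upd_twist)
  hence "f (b(i := x, j := y)) = \<alpha> 0 + \<beta> 0 * x + (\<alpha> 1 - \<alpha> 0) * y + (\<beta> 1 - \<beta> 0) * x * y" for x y
    by (simp add: h algebra_simps)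
  thus ?thesis by (rule that)
qed

section \<open>Closure properties of multiaffine functions\<close>

lemma multiaffine_const: "multiaffine (\<lambda>b. c)"
  unfolding multiaffine_def by (metis add.right_neutral mult_zero_left)

lemma multiaffine_add:
  assumes "multiaffine f" "multiaffine g"
  shows "multiaffine (\<lambda>b. f b + g b)"
  unfolding multiaffine_def
proof (intro allI)
  fix b i
  obtain \<alpha> \<beta> \<gamma> \<delta> where "\<And>x. f (b(i := x)) = \<alpha> + \<beta> * x" "\<And>x. g (b(i := x)) = \<gamma> + \<delta> * x"
    using assms unfolding multiaffine_def by meson
  hence "\<forall>x. f (b(i := x)) + g (b(i := x)) = (\<alpha> + \<gamma>) + (\<beta> + \<delta>) * x"
    by (simp add: algebra_simps)
  thus "\<exists>\<alpha> \<beta>. \<forall>x. f (b(i := x)) + g (b(i := x)) = \<alpha> + \<beta> * x" by blast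
qed

lemma multiaffine_cmult:
  assumes "multiaffine f"
  shows "multiaffine (\<lambda>b. c * f b)"
  unfolding multiaffine_def
proof (intro allI)
  fix b i
  obtain \<alpha> \<beta> where "\<And>x. f (b(i := x)) = \<alpha> + \<beta> * x"
    using assms unfolding multiaffine_def by meson
  hence "\<forall>x. c * f (b(i := x)) = c * \<alpha> + (c * \<beta>) * x" by (simp add: algebra_simps)
  thus "\<exists>\<alpha> \<beta>. \<forall>x. c * f (b(i := x)) = \<alpha> + \<beta> * x" by blast
qed

lemma multiaffine_sum:
  assumes "\<And>k. k \<in> A \<Longrightarrow> multiaffine (f k)"
  shows "multiaffine (\<lambda>b. \<Sum>k\<in>A. f k b)"
  using assms
  by (induction A rule: infinite_finite_induct)
    (auto intro: multiaffine_add multiaffine_const)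

lemma multiaffine_comp_bij:
  fixes \<sigma> :: "'a \<Rightarrow> 'a"
  assumes f: "multiaffine f" and \<sigma>: "bij \<sigma>"
  shows "multiaffine (\<lambda>b. f (b \<circ> \<sigma>))"
  unfolding multiaffine_def
proof (intro allI)
  fix b :: "'a \<Rightarrow> complex" and i
  have "(b(i := x)) \<circ> \<sigma> = (b \<circ> \<sigma>)(inv \<sigma> i := x)" for x
    using bij_inv_eq_iff[OF \<sigma>, of _ i] by (auto simp: fun_eq_iff)
  thus "\<exists>\<alpha> \<beta>. \<forall>x. f ((b(i := x)) \<circ> \<sigma>) = \<alpha> + \<beta> * x"
    using f unfolding multiaffine_def by simp
qed

lemma multiaffine_prod_one_minus:
  assumes "finite A"
  shows "multiaffine (\<lambda>b. \<Prod>k\<in>A. 1 - a k * b k)"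
  unfolding multiaffine_def
proof (intro allI)
  fix b i
  show "\<exists>\<alpha> \<beta>. \<forall>x. (\<Prod>k\<in>A. 1 - a k * (b(i := x)) k) = \<alpha> + \<beta> * x"
  proof (cases "i \<in> A")
    case True
    define P where "P = (\<Prod>k\<in>A - {i}. 1 - a k * b k)"
    have "(\<Prod>k\<in>A. 1 - a k * (b(i := x)) k) = P + (- a i * P) * x" for x
    proof -
      have "(\<Prod>k\<in>A. 1 - a k * (b(i := x)) k)
          = (1 - a i * x) * (\<Prod>k\<in>A - {i}. 1 - a k * (b(i := x)) k)"
        using assms True by (subst prod.remove[of A i]) auto
      also have "(\<Prod>k\<in>A - {i}. 1 - a k * (b(i := x)) k) = P"
        unfolding P_def by (rule prod.cong) auto
      finally show ?thesis by (simp add: algebra_simps)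
    qed
    thus ?thesis by blast
  next
    case False
    hence "(\<Prod>k\<in>A. 1 - a k * (b(i := x)) k) = (\<Prod>k\<in>A. 1 - a k * b k) + 0 * x" for x
      by (auto intro!: prod.cong)
    thus ?thesis by blast
  qed
qed

text \<open>With all other coordinates frozen, f is bilinear in \<open>b i\<close> and
  \<open>b j\<close>, and the transposition exchanges its arguments.\<close>

lemma nonvanishing0_swap_average:
  fixes p :: real and f :: "('a \<Rightarrow> complex) \<Rightarrow> complex"
  assumes f: "multiaffine f" "nonvanishing0 f" and ij: "i \<noteq> j" and p: "0 \<le> p" "p \<le> 1"
  shows "nonvanishing0 (\<lambda>b. of_real p * f b + of_real (1 - p) * f (b \<circ> transpose i j))"
  unfolding nonvanishing0_def
proof (intro allI impI)
  fix b :: "'a \<Rightarrow> complex" assume b: "\<forall>i. b i \<in> uhp0"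
  obtain A B C D where h: "\<And>x y. f (b(i := x, j := y)) = A + B * x + C * y + D * x * y"
    using multiaffine_bilinear[OF f(1) ij, of b] by blast
  have nz: "A + B * x + C * y + D * x * y \<noteq> 0" if "x \<in> uhp0" "y \<in> uhp0" for x y
    unfolding h[symmetric] using f(2) b that unfolding nonvanishing0_def by auto
  have "b \<circ> transpose i j = b(i := b j, j := b i)"
    using ij by (auto simp: fun_eq_iff transpose_def)
  moreover have "b = b(i := b i, j := b j)" by simp
  ultimately have "of_real p * f b + of_real (1 - p) * f (b \<circ> transpose i j)
      = of_real p * (A + B * b i + C * b j + D * b i * b j)
        + of_real (1 - p) * (A + B * b j + C * b i + D * b j * b i)"
    by (metis h)
  thus "of_real p * f b + of_real (1 - p) * f (b \<circ> transpose i j) \<noteq> 0"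
    using bilinear_swap_average_nonzero0[OF nz p, of "b i" "b j"] b by simp
qed

text \<open>A permutation of \<open>insert m B\<close> is a permutation of B followed by a
  transposition of m with some element. The sum over \<open>insert m B\<close> thus arises from card
  B + 1 copies of the sum over B by one swap average for each element of B.\<close>

lemma nonvanishing0_sum_permutations:
  assumes "finite A" and f: "multiaffine f" "nonvanishing0 f"
  shows "nonvanishing0 (\<lambda>b. \<Sum>\<sigma> | \<sigma> permutes A. f (b \<circ> \<sigma>))"
  using assms(1)
proof (induction A)
  case empty
  thus ?case using f by simp
next
  case (insert m B)
  define g where "g b = (\<Sum>\<sigma> | \<sigma> permutes B. f (b \<circ> \<sigma>))" for b
  have g_aff: "multiaffine g"
    unfolding g_def using f
    by (intro multiaffine_sum multiaffine_comp_bij) (auto simp: permutes_bij)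
  have g_sym: "g (b \<circ> q) = g b" if "q permutes B" for b q
    unfolding g_def
  proof (rule sum.reindex_bij_witness[of _ "\<lambda>\<sigma>. inv q \<circ> \<sigma>" "\<lambda>\<sigma>. q \<circ> \<sigma>"])
    fix \<sigma> assume "\<sigma> \<in> {\<sigma>. \<sigma> permutes B}"
    hence \<sigma>: "\<sigma> permutes B" by simp
    show "inv q \<circ> (q \<circ> \<sigma>) = \<sigma>" "q \<circ> (inv q \<circ> \<sigma>) = \<sigma>"
      by (simp_all only: comp_assoc[symmetric] permutes_inv_o[OF that] id_comp)
    show "q \<circ> \<sigma> \<in> {\<sigma>. \<sigma> permutes B}" "inv q \<circ> \<sigma> \<in> {\<sigma>. \<sigma> permutes B}"
      using permutes_compose[OF \<sigma> that] permutes_compose[OF \<sigma> permutes_inv[OF that]] by simp_all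
    show "f (b \<circ> (q \<circ> \<sigma>)) = f (b \<circ> q \<circ> \<sigma>)" by (simp only: comp_assoc)
  qed
  \<comment> \<open>The weight of \<open>g b\<close> drops by one with every further swap: for \<open>l\<close> the current weight, applying
    the swap with probability \<open>1 / l\<close> leaves \<open>l - 1\<close> on \<open>g b\<close>, and the terms already present
    are invariant by the symmetry of \<open>g\<close>.\<close>
  define G where "G C b = of_nat (card B + 1 - card C) * g b + (\<Sum>i\<in>C. g (b \<circ> transpose m i))"
    for C b
  have G_aff: "multiaffine (G C)" for C
    unfolding G_def
    by (intro multiaffine_add multiaffine_cmult multiaffine_sum multiaffine_comp_bij g_aff) auto
  have G_nz: "nonvanishing0 (G C)" if "C \<subseteq> B" for C
    using finite_subset[OF that insert.hyps(1)] that
  proof (induction C rule: finite_subset_induct')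
    case empty
    show ?case
      using insert.IH unfolding nonvanishing0_def G_def g_def
      by (simp del: of_nat_Suc)
  next
    case (insert j C)
    define l where "l = card B + 1 - card C"
    \<comment> \<open>This makes the truncated subtraction exact: l \<ge> 2, so a positive weight l
      - 1 remains.\<close>
    have "card (insert j C) \<le> card B"
      using insert \<open>finite B\<close> by (intro card_mono) auto
    hence l: "l \<ge> 2" "card B + 1 - card (insert j C) = l - 1"
      using insert by (auto simp: l_def)
    define p where "p = 1 - 1 / real l"
    have "m \<noteq> j" using insert \<open>m \<notin> B\<close> by auto
    have sw: "g (b \<circ> transpose m j \<circ> transpose m i) = g (b \<circ> transpose m i)" if "i \<in> C" for b i
    proof -
      have i: "i \<noteq> m" "i \<noteq> j" "i \<in> B" using that insert \<open>m \<notin> B\<close> by auto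
      \<comment> \<open>Moving the new swap past an old one turns it into a transposition inside B,
        which g absorbs.\<close>
      have "transpose m j \<circ> transpose m i = transpose m i \<circ> transpose i j"
        using i \<open>m \<noteq> j\<close> by (auto simp: fun_eq_iff transpose_def)
      hence "b \<circ> transpose m j \<circ> transpose m i = (b \<circ> transpose m i) \<circ> transpose i j"
        by (simp add: comp_assoc)
      thus ?thesis
        using g_sym[OF permutes_swap_id[of i B j]] i insert by simp
    qed
    have "G (insert j C) = (\<lambda>b. of_real p * G C b + of_real (1 - p) * G C (b \<circ> transpose m j))"
    proof
      fix b
      define S where "S = (\<Sum>i\<in>C. g (b \<circ> transpose m i))"
      have 1: "G C b = of_nat l * g b + S" by (simp add: G_def S_def l_def)
      have 2: "G C (b \<circ> transpose m j) = of_nat l * g (b \<circ> transpose m j) + S"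
        by (simp add: G_def S_def l_def sw)
      have 3: "G (insert j C) b = of_nat (l - 1) * g b + g (b \<circ> transpose m j) + S"
        unfolding G_def l(2) using insert by (simp add: S_def)
      show "G (insert j C) b = of_real p * G C b + of_real (1 - p) * G C (b \<circ> transpose m j)"
        unfolding 1 2 3 using l by (simp add: p_def field_simps of_nat_diff)
    qed
    moreover have "0 \<le> p" "p \<le> 1" using l by (auto simp: p_def)
    ultimately show ?case
      using nonvanishing0_swap_average[OF G_aff, of C m j p] insert.IH \<open>m \<noteq> j\<close> by simp
  qed
  \<comment> \<open>For C = B the weight of \<open>g b\<close> has dropped to 1; it is the term of
    the trivial transposition of m with itself.\<close>
  have "(\<lambda>b. \<Sum>\<sigma> | \<sigma> permutes insert m B. f (b \<circ> \<sigma>)) = G B"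
    using insert.hyps
    by (subst sum_over_permutations_insert) (auto simp: G_def g_def comp_assoc fun_eq_iff)
  thus ?case using G_nz[of B] by (simp only: subset_refl)
qed


section \<open>The Lieb-Sokal step\<close>

lemma prod_fun_upd:
  fixes x :: "'a \<Rightarrow> complex"
  assumes "finite A"
  shows "(\<Prod>u\<in>A. (x(j := z)) u) = (if j \<in> A then z * (\<Prod>u\<in>A - {j}. x u) else (\<Prod>u\<in>A. x u))"
proof (cases "j \<in> A")
  case True
  have "(\<Prod>u\<in>A - {j}. (x(j := z)) u) = (\<Prod>u\<in>A - {j}. x u)" by (rule prod.cong) auto
  thus ?thesis using assms True by (simp add: prod.remove[of A j])
next
  case False
  thus ?thesis by (auto intro!: prod.cong)
qed

text \<open>With \<open>f = P + t * Q\<close> as a polynomial in \<open>z\<close>, the second function is \<open>P - \<partial>Q/\<partial>z\<close>.\<close>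

definition lieb_sokal_pair :: "(complex \<Rightarrow> complex \<Rightarrow> complex) \<Rightarrow> (complex \<Rightarrow> complex) \<Rightarrow> bool" where
  "lieb_sokal_pair f g \<longleftrightarrow>
     (\<exists>\<alpha> \<beta> \<gamma> \<delta>. \<forall>z t. f z t = \<alpha> + \<beta> * z + \<gamma> * t + \<delta> * z * t \<and> g z = \<alpha> + \<beta> * z - \<delta>)"

lemma lieb_sokal_pairI:
  assumes "\<And>z t. f z t = \<alpha> + \<beta> * z + \<gamma> * t + \<delta> * z * t" "\<And>z. g z = \<alpha> + \<beta> * z - \<delta>"
  shows "lieb_sokal_pair f g"
  unfolding lieb_sokal_pair_def using assms by blast

lemma lieb_sokal_pairE:
  assumes "lieb_sokal_pair f g"
  obtains \<alpha> \<beta> \<gamma> \<delta> where "\<And>z t. f z t = \<alpha> + \<beta> * z + \<gamma> * t + \<delta> * z * t" "\<And>z. g z = \<alpha> + \<beta> * z - \<delta>"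
  using assms unfolding lieb_sokal_pair_def by blast

section \<open>Linearity of the Lieb-Sokal step, reducing it to monomials\<close>

lemma lieb_sokal_pair_cmult:
  assumes "lieb_sokal_pair f g"
  shows "lieb_sokal_pair (\<lambda>z t. c * f z t) (\<lambda>z. c * g z)"
proof -
  obtain \<alpha> \<beta> \<gamma> \<delta> where 1: "\<And>z t. f z t = \<alpha> + \<beta> * z + \<gamma> * t + \<delta> * z * t"
    "\<And>z. g z = \<alpha> + \<beta> * z - \<delta>"
    using assms by (rule lieb_sokal_pairE) blast
  show ?thesis unfolding 1
    by (rule lieb_sokal_pairI[of _ "c * \<alpha>" "c * \<beta>" "c * \<gamma>" "c * \<delta>"]) (simp_all add: algebra_simps)
qed

lemma lieb_sokal_pair_add:
  assumes "lieb_sokal_pair f g" "lieb_sokal_pair f' g'"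
  shows "lieb_sokal_pair (\<lambda>z t. f z t + f' z t) (\<lambda>z. g z + g' z)"
proof -
  obtain \<alpha> \<beta> \<gamma> \<delta> where 1: "\<And>z t. f z t = \<alpha> + \<beta> * z + \<gamma> * t + \<delta> * z * t"
    "\<And>z. g z = \<alpha> + \<beta> * z - \<delta>"
    using assms(1) by (rule lieb_sokal_pairE) blast
  obtain \<alpha>' \<beta>' \<gamma>' \<delta>' where 2: "\<And>z t. f' z t = \<alpha>' + \<beta>' * z + \<gamma>' * t + \<delta>' * z * t"
    "\<And>z. g' z = \<alpha>' + \<beta>' * z - \<delta>'"
    using assms(2) by (rule lieb_sokal_pairE) blast
  show ?thesis unfolding 1 2
    by (rule lieb_sokal_pairI[of _ "\<alpha> + \<alpha>'" "\<beta> + \<beta>'" "\<gamma> + \<gamma>'" "\<delta> + \<delta>'"])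
      (simp_all add: algebra_simps)
qed

lemma lieb_sokal_pair_zero: "lieb_sokal_pair (\<lambda>z t. 0) (\<lambda>z. 0)"
  by (rule lieb_sokal_pairI[of _ 0 0 0 0]) simp_all

lemma lieb_sokal_pair_sum:
  assumes "\<And>i. i \<in> J \<Longrightarrow> lieb_sokal_pair (f i) (g i)"
  shows "lieb_sokal_pair (\<lambda>z t. \<Sum>i\<in>J. f i z t) (\<lambda>z. \<Sum>i\<in>J. g i z)"
  using assms
proof (induction J rule: infinite_finite_induct)
  case (insert i J)
  have "lieb_sokal_pair (\<lambda>z t. f i z t + (\<Sum>i\<in>J. f i z t)) (\<lambda>z. g i z + (\<Sum>i\<in>J. g i z))"
    using insert by (intro lieb_sokal_pair_add) auto
  thus ?case using insert.hyps by simp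
qed (simp_all add: lieb_sokal_pair_zero)

text \<open>The monomial \<open>(\<Prod>s\<in>S. w s) * (\<Prod>u\<in>V. x u)\<close> after the variables \<open>w s\<close> with \<open>s \<in> U\<close> have been
  replaced by minus the derivative in direction \<open>vert s\<close>.\<close>

definition lieb_sokal_term ::
    "'v set \<Rightarrow> ('w \<Rightarrow> 'v) \<Rightarrow> 'w set \<Rightarrow> 'w set \<Rightarrow> ('v \<Rightarrow> complex) \<Rightarrow> ('w \<Rightarrow> complex) \<Rightarrow> complex" where
  "lieb_sokal_term V vert U S x w =
     (if inj_on vert (S \<inter> U)
      then (-1) ^ card (S \<inter> U) * (\<Prod>u\<in>V - vert ` (S \<inter> U). x u) * (\<Prod>s\<in>S - U. w s)
      else 0)"

text \<open>If s is absent from S, t does not occur. Otherwise the derivative deletes the factor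
  \<open>x (vert s)\<close>, or gives 0 when an earlier derivative has removed it; the latter is the
  loss of injectivity.\<close>

lemma lieb_sokal_term_insert:
  assumes V: "finite V" and S: "finite S" and s: "s \<notin> U" "vert s \<in> V"
  shows "lieb_sokal_pair
           (\<lambda>z t. lieb_sokal_term V vert U S (x(vert s := z)) (w(s := t)))
           (\<lambda>z. lieb_sokal_term V vert (insert s U) S (x(vert s := z)) w)"
proof (cases "s \<in> S")
  case False
  hence 1: "S \<inter> insert s U = S \<inter> U" "S - insert s U = S - U" "s \<notin> S - U" by auto
  define A where "A = V - vert ` (S \<inter> U)"
  have finA: "finite A" using V by (simp add: A_def)
  define c where "c = (if inj_on vert (S \<inter> U) then (-1) ^ card (S \<inter> U) * (\<Prod>r\<in>S - U. w r) else 0)"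
  have "lieb_sokal_term V vert U S (x(vert s := z)) (w(s := t)) =
      c * (if vert s \<in> A then z * (\<Prod>u\<in>A - {vert s}. x u) else (\<Prod>u\<in>A. x u))"
    and "lieb_sokal_term V vert (insert s U) S (x(vert s := z)) w =
      c * (if vert s \<in> A then z * (\<Prod>u\<in>A - {vert s}. x u) else (\<Prod>u\<in>A. x u))" for z t
    unfolding lieb_sokal_term_def 1(1,2) A_def[symmetric] c_def prod_fun_upd[OF finA]
      prod_fun_upd[OF finite_Diff[OF S]] using False by simp_all
  thus ?thesis
    by (intro lieb_sokal_pairI[of _ "if vert s \<in> A then 0 else c * (\<Prod>u\<in>A. x u)"
          "if vert s \<in> A then c * (\<Prod>u\<in>A - {vert s}. x u) else 0" 0 0]) auto
next
  case True
  define T where "T = S \<inter> U"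
  define c where "c = (-1) ^ card T * (\<Prod>r\<in>S - U - {s}. w r)"
  have 1: "S \<inter> insert s U = insert s T" "S - insert s U = S - U - {s}" "s \<in> S - U" "s \<notin> T"
    "finite T"
    using True s S by (auto simp: T_def)
  have new: "lieb_sokal_term V vert (insert s U) S (x(vert s := z)) w =
      (if inj_on vert T \<and> vert s \<notin> vert ` T
       then - c * (\<Prod>u\<in>V - vert ` T - {vert s}. x u) else 0)" for z
  proof -
    have "V - vert ` insert s T = V - vert ` T - {vert s}" by auto
    moreover have "(\<Prod>u\<in>V - vert ` T - {vert s}. (x(vert s := z)) u) = (\<Prod>u\<in>V - vert ` T - {vert s}. x u)"
      by (rule prod.cong) auto
    moreover have "inj_on vert (insert s T) \<longleftrightarrow> inj_on vert T \<and> vert s \<notin> vert ` T"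
      using 1(4) by (simp add: inj_on_insert)
    ultimately show ?thesis
      unfolding lieb_sokal_term_def 1(1,2) c_def using 1(4,5) by (simp del: fun_upd_apply)
  qed
  have old: "lieb_sokal_term V vert U S (x(vert s := z)) (w(s := t)) =
      (if inj_on vert T then c * t * (if vert s \<in> V - vert ` T
         then z * (\<Prod>u\<in>V - vert ` T - {vert s}. x u) else (\<Prod>u\<in>V - vert ` T. x u)) else 0)" for z t
    unfolding lieb_sokal_term_def T_def[symmetric] prod_fun_upd[OF finite_Diff[OF V]]
      prod_fun_upd[OF finite_Diff[OF S]] c_def using 1(3) by simp
  show ?thesis
  proof (cases "inj_on vert T \<and> vert s \<notin> vert ` T")
    case True
    thus ?thesis unfolding new old using s
      by (intro lieb_sokal_pairI[of _ 0 0 0 "c * (\<Prod>u\<in>V - vert ` T - {vert s}. x u)"]) simp_all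
  next
    case False
    \<comment> \<open>Here the old term does not depend on z, so \<delta> = 0 and the new term is
      zero.\<close>
    thus ?thesis unfolding new old using s
      by (intro lieb_sokal_pairI[of _ 0 0 "if inj_on vert T then c * (\<Prod>u\<in>V - vert ` T. x u) else 0" 0])
        auto
  qed
qed

text \<open>The auxiliary variables are eliminated one by one. At the start the sum is the
  hypothesis times a product of nonzero \<open>x u\<close>.\<close>

lemma lieb_sokal_sum:
  fixes c :: "'i \<Rightarrow> complex" and S :: "'i \<Rightarrow> 'w set" and vert :: "'w \<Rightarrow> 'v"
  assumes V: "finite V" and W: "finite W" "vert ` W \<subseteq> V" and S: "\<And>i. i \<in> J \<Longrightarrow> S i \<subseteq> W"
    and nz: "\<And>w. (\<And>s. w s \<in> uhp0) \<Longrightarrow> (\<Sum>i\<in>J. c i * (\<Prod>s\<in>S i. w s)) \<noteq> 0"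
    and x: "\<And>u. u \<in> V \<Longrightarrow> Im (x u) > 0"
  shows "(\<Sum>i\<in>J. c i * (if inj_on vert (S i)
           then (-1) ^ card (S i) * (\<Prod>u\<in>V - vert ` S i. x u) else 0)) \<noteq> 0"
proof -
  \<comment> \<open>The claim ranges over all x and w, because each step uses nonvanishing for every
    value of one x and one w.\<close>
  have "(\<Sum>i\<in>J. c i * lieb_sokal_term V vert U (S i) x w) \<noteq> 0"
    if "U \<subseteq> W" "\<And>u. u \<in> V \<Longrightarrow> Im (x u) > 0" "\<And>s. w s \<in> uhp0" for U x w
    using finite_subset[OF that(1) W(1)] that
  proof (induction U arbitrary: x w rule: finite_induct)
    case empty
    have "(\<Sum>i\<in>J. c i * lieb_sokal_term V vert {} (S i) x w)
        = (\<Prod>u\<in>V. x u) * (\<Sum>i\<in>J. c i * (\<Prod>s\<in>S i. w s))"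
      by (simp add: lieb_sokal_term_def sum_distrib_left mult_ac)
    moreover have "x u \<noteq> 0" if "u \<in> V" for u using empty(2)[OF that] by auto
    ultimately show ?case using nz[OF empty(3)] V by simp
  next
    case (insert s U)
    let ?f = "\<lambda>z t. \<Sum>i\<in>J. c i * lieb_sokal_term V vert U (S i) (x(vert s := z)) (w(s := t))"
    let ?g = "\<lambda>z. \<Sum>i\<in>J. c i * lieb_sokal_term V vert (insert s U) (S i) (x(vert s := z)) w"
    have "lieb_sokal_pair ?f ?g"
    proof (intro lieb_sokal_pair_sum lieb_sokal_pair_cmult)
      fix i assume "i \<in> J"
      thus "lieb_sokal_pair
          (\<lambda>z t. lieb_sokal_term V vert U (S i) (x(vert s := z)) (w(s := t)))
          (\<lambda>z. lieb_sokal_term V vert (insert s U) (S i) (x(vert s := z)) w)"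
        using insert.hyps insert.prems(1) W S V
        by (intro lieb_sokal_term_insert) (auto intro: finite_subset)
    qed
    then obtain \<alpha> \<beta> \<gamma> \<delta> where f: "\<And>z t. ?f z t = \<alpha> + \<beta> * z + \<gamma> * t + \<delta> * z * t"
      and g: "\<And>z. ?g z = \<alpha> + \<beta> * z - \<delta>"
      by (rule lieb_sokal_pairE) blast
    have "\<alpha> + \<beta> * z + \<gamma> * t + \<delta> * z * t \<noteq> 0" if "Im z > 0" "t \<in> uhp0" for z t
      unfolding f[symmetric] using insert.prems that by (intro insert.IH) auto
    moreover have "Im (x (vert s)) > 0" using insert.prems W by auto
    ultimately have "?g (x (vert s)) \<noteq> 0" unfolding g by (rule lieb_sokal_bilinear)
    thus ?case by simp
  qed
  \<comment> \<open>All auxiliary variables are gone by now; any w in \<open>uhp0\<close>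
    serves.\<close>
  from this[of W x "\<lambda>_. 0"] x
  have "(\<Sum>i\<in>J. c i * lieb_sokal_term V vert W (S i) x (\<lambda>_. 0)) \<noteq> 0" by (auto simp: uhp0_def)
  moreover have "lieb_sokal_term V vert W (S i) x (\<lambda>_. 0) =
      (if inj_on vert (S i) then (-1) ^ card (S i) * (\<Prod>u\<in>V - vert ` S i. x u) else 0)"
    if "i \<in> J" for i
  proof -
    have *: "S i \<inter> W = S i" "S i - W = {}" using S[OF that] by auto
    show ?thesis unfolding lieb_sokal_term_def * by simp
  qed
  ultimately show ?thesis by (simp cong: sum.cong)
qed

text \<open>The equation x y = 1 has no solution in \<open>uhp0\<close>, as inversion maps the upper
  half-plane to the lower one. Symmetrising in b alone, with a fixed, gives the claim.\<close>

lemma sum_permutations_prod_nonzero: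
  assumes A: "finite A" and a: "\<And>k. a k \<in> uhp0" and b: "\<And>k. b k \<in> uhp0"
  shows "(\<Sum>\<sigma> | \<sigma> permutes A. \<Prod>k\<in>A. 1 - a k * b (\<sigma> k)) \<noteq> 0"
proof -
  have "1 - x * y \<noteq> 0" if "x \<in> uhp0" "y \<in> uhp0" for x y
  proof
    assume "1 - x * y = 0"
    hence "x * y = 1" by simp
    hence "y \<noteq> 0" "x = 1 / y" "x \<noteq> 0" by (auto simp: eq_divide_eq)
    moreover from this have "Im y > 0" using that by (auto simp: uhp0_def)
    ultimately have "Im x < 0" by (simp add: Im_divide sum_power2_gt_zero_iff)
    with that \<open>x \<noteq> 0\<close> show False by (auto simp: uhp0_def)
  qed
  hence "nonvanishing0 (\<lambda>b. \<Prod>k\<in>A. 1 - a k * b k)"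
    using A a by (simp add: nonvanishing0_def)
  from nonvanishing0_sum_permutations[OF A multiaffine_prod_one_minus[OF A] this] b
  show ?thesis unfolding nonvanishing0_def by simp
qed

section \<open>Evaluation of the averaged matching polynomial\<close>

lemma eval_poly_superset:
  assumes "finite K" "Poly_Mapping.keys f \<subseteq> K"
  shows "eval_poly f y = (\<Sum>m\<in>K. Poly_Mapping.lookup f m *
           (\<Prod>v\<in>Poly_Mapping.keys m. y v ^ Poly_Mapping.lookup m v))"
  unfolding eval_poly_def using assms
  by (intro sum.mono_neutral_left) (auto simp: in_keys_iff)

lemma eval_poly_zero: "eval_poly 0 y = 0"
  by (simp add: eval_poly_def)

lemma eval_poly_add: "eval_poly (f + g) y = eval_poly f y + eval_poly g y"
proof -
  let ?K = "Poly_Mapping.keys f \<union> Poly_Mapping.keys g"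
  have "Poly_Mapping.keys (f + g) \<subseteq> ?K" by (rule Poly_Mapping.keys_add)
  thus ?thesis
    by (simp add: eval_poly_superset[of ?K] lookup_add algebra_simps sum.distrib)
qed

lemma eval_poly_sum: "eval_poly (\<Sum>i\<in>A. f i) y = (\<Sum>i\<in>A. eval_poly (f i) y)"
  by (induction A rule: infinite_finite_induct) (simp_all add: eval_poly_zero eval_poly_add)

lemma poly_vars_sum: "poly_vars (\<Sum>i\<in>A. f i) \<subseteq> (\<Union>i\<in>A. poly_vars (f i))"
  unfolding poly_vars_def using keys_sum[of f A] by blast

definition squarefree_monom :: "'v set \<Rightarrow> 'v \<Rightarrow>\<^sub>0 nat" where
  "squarefree_monom A = (\<Sum>u\<in>A. Poly_Mapping.single u 1)"

lemma lookup_squarefree_monom: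
  "finite A \<Longrightarrow> Poly_Mapping.lookup (squarefree_monom A) v = (if v \<in> A then 1 else 0)"
  by (simp add: squarefree_monom_def lookup_sum lookup_single when_def)

lemma keys_squarefree_monom: "finite A \<Longrightarrow> Poly_Mapping.keys (squarefree_monom A) = A"
  by (auto simp: in_keys_iff lookup_squarefree_monom split: if_splits)

lemma eval_poly_single_squarefree:
  assumes "finite A"
  shows "eval_poly (Poly_Mapping.single (squarefree_monom A) c) y = c * (\<Prod>u\<in>A. y u)"
  using assms by (simp add: eval_poly_def keys_squarefree_monom lookup_squarefree_monom)

lemma prod_var_poly:
  assumes "finite A"
  shows "(\<Prod>u\<in>A. var_poly u) = Poly_Mapping.single (squarefree_monom A) 1"
  using assms
  by (induction A rule: finite_induct)
    (simp_all add: squarefree_monom_def var_poly_def mult_single)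

lemma minus_one_power_poly: "((- 1) ^ k :: 'v cpoly) = Poly_Mapping.single 0 ((- 1) ^ k)"
proof (induction k)
  case (Suc k)
  have "(- 1 :: 'v cpoly) = Poly_Mapping.single 0 (- 1)" by (simp add: single_uminus)
  thus ?case using Suc by (simp add: mult_single)
qed simp

text \<open>Each matching becomes a single signed squarefree monomial, so evaluation and variables
  can be read off term by term.\<close>

lemma matching_poly_eq:
  assumes "finite (mg_verts H)"
  shows "matching_poly H = (\<Sum>M\<in>matchings H.
    Poly_Mapping.single (squarefree_monom (mg_verts H - covered_verts H M)) ((- 1) ^ card M))"
  unfolding matching_poly_def using assms
  by (simp add: prod_var_poly minus_one_power_poly mult_single)

lemma d_matching_poly_eq:
  fixes G :: "('v, 'e) pre_digraph"
  assumes "finite (verts G)"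
  shows "d_matching_poly d G arev Ep =
    (\<Sum>\<sigma>\<in>coverings d G arev. \<Sum>M\<in>matchings (covering_graph d G Ep \<sigma>).
       Poly_Mapping.single
         (squarefree_monom (verts G \<times> {1..d} - covered_verts (covering_graph d G Ep \<sigma>) M))
         (1 / of_nat (card (coverings d G arev)) * (- 1) ^ card M))"
proof -
  have "finite (mg_verts (covering_graph d G Ep \<sigma>))" for \<sigma>
    using assms by (simp add: covering_graph_def)
  moreover have "mg_verts (covering_graph d G Ep \<sigma>) = verts G \<times> {1..d}" for \<sigma>
    by (simp add: covering_graph_def)
  ultimately show ?thesis
    by (simp add: d_matching_poly_def matching_poly_eq const_poly_def sum_distrib_left mult_single)
qed

lemma poly_vars_d_matching_poly:
  assumes "finite (verts G)"
  shows "poly_vars (d_matching_poly d G arev Ep) \<subseteq> verts G \<times> {1..d}"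
proof -
  have *: "poly_vars (Poly_Mapping.single (squarefree_monom (verts G \<times> {1..d} - B)) c) \<subseteq> verts G \<times> {1..d}"
    for B and c :: complex
    using assms by (auto simp: poly_vars_def keys_squarefree_monom)
  show ?thesis unfolding d_matching_poly_eq[OF assms]
    by (intro order.trans[OF poly_vars_sum] UN_least *)
qed

lemma eval_d_matching_poly:
  assumes "finite (verts G)"
  shows "eval_poly (d_matching_poly d G arev Ep) y =
    1 / of_nat (card (coverings d G arev)) *
    (\<Sum>\<sigma>\<in>coverings d G arev. \<Sum>M\<in>matchings (covering_graph d G Ep \<sigma>).
       (- 1) ^ card M * (\<Prod>u\<in>verts G \<times> {1..d} - covered_verts (covering_graph d G Ep \<sigma>) M. y u))"
  using assms
  by (simp add: d_matching_poly_eq eval_poly_sum eval_poly_single_squarefree sum_distrib_left mult.assoc)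

section \<open>Half-edges of coverings\<close>

text \<open>\<open>(e, k, True)\<close> is the half-edge of a lift of \<open>e\<close> at the \<open>k\<close>-th copy of its head, and \<open>(e, k, False)\<close>
  the one at the \<open>k\<close>-th copy of its tail.\<close>

definition half_edges :: "('e \<Rightarrow> nat \<Rightarrow> nat) \<Rightarrow> ('e \<times> nat) set \<Rightarrow> ('e \<times> nat \<times> bool) set" where
  "half_edges \<sigma> M = (\<lambda>(e, k). (e, k, True)) ` M \<union> (\<lambda>(e, k). (e, \<sigma> e k, False)) ` M"

text \<open>The end vertex is independent of \<sigma>, which only decides how half-edges pair up.
  One derivative substitution therefore serves all coverings at once.\<close>

definition half_edge_vert :: "('v, 'e) pre_digraph \<Rightarrow> 'e \<times> nat \<times> bool \<Rightarrow> 'v \<times> nat" where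
  "half_edge_vert G = (\<lambda>(e, k, b). (if b then head G e else tail G e, k))"

lemma inj_on_shifted_edges:
  assumes "\<And>e. e \<in> Ep \<Longrightarrow> inj (\<sigma> e)" "M \<subseteq> Ep \<times> A"
  shows "inj_on (\<lambda>(e, k). (e, \<sigma> e k, False)) M"
  using assms by (auto simp: inj_on_def)

text \<open>Evenness cancels the signs of the derivatives, leaving the sign of the matching.\<close>

lemma card_half_edges:
  assumes \<sigma>: "\<And>e. e \<in> Ep \<Longrightarrow> inj (\<sigma> e)" and M: "M \<subseteq> Ep \<times> A" "finite M"
  shows "card (half_edges \<sigma> M) = 2 * card M"
proof -
  have "inj_on (\<lambda>(e, k). (e, k, True)) M" by (auto simp: inj_on_def)
  moreover have "inj_on (\<lambda>(e, k). (e, \<sigma> e k, False)) M"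
    using \<sigma> M(1) by (rule inj_on_shifted_edges)
  ultimately show ?thesis unfolding half_edges_def using M
    by (subst card_Un_disjoint) (auto simp: card_image)
qed

lemma prod_half_edges:
  fixes w :: "'e \<times> nat \<times> bool \<Rightarrow> complex"
  assumes \<sigma>: "\<And>e. e \<in> Ep \<Longrightarrow> inj (\<sigma> e)" and M: "M \<subseteq> Ep \<times> A" "finite M"
  shows "(\<Prod>s\<in>half_edges \<sigma> M. w s) = (\<Prod>(e, k)\<in>M. w (e, k, True) * w (e, \<sigma> e k, False))"
proof -
  have "inj_on (\<lambda>(e, k). (e, k, True)) M" by (auto simp: inj_on_def)
  moreover have "inj_on (\<lambda>(e, k). (e, \<sigma> e k, False)) M"
    using \<sigma> M(1) by (rule inj_on_shifted_edges)
  ultimately show ?thesis unfolding half_edges_def using M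
    by (subst prod.union_disjoint)
      (auto simp: prod.reindex prod.distrib comp_def case_prod_unfold)
qed

lemma covered_verts_covering_graph:
  "covered_verts (covering_graph d G Ep \<sigma>) M = half_edge_vert G ` half_edges \<sigma> M"
  by (force simp: covered_verts_def covering_graph_def half_edges_def half_edge_vert_def image_Un)

text \<open>A collision of the two half-edges of one lift is a loop, and one between different lifts
  is a shared vertex. Injectivity of each \<open>\<sigma> e\<close> keeps half-edges of different
  lifts distinct.\<close>

lemma matchings_covering_graph:
  assumes \<sigma>: "\<And>e. e \<in> Ep \<Longrightarrow> inj (\<sigma> e)"
  shows "matchings (covering_graph d G Ep \<sigma>) =
    {M. M \<subseteq> Ep \<times> {1..d} \<and> inj_on (half_edge_vert G) (half_edges \<sigma> M)}"
proof -
  have *: "(\<forall>e\<in>M. proper_uprod (mg_ends (covering_graph d G Ep \<sigma>) e)) \<and>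
      (\<forall>e\<in>M. \<forall>f\<in>M. e \<noteq> f \<longrightarrow>
         set_uprod (mg_ends (covering_graph d G Ep \<sigma>) e)
           \<inter> set_uprod (mg_ends (covering_graph d G Ep \<sigma>) f) = {})
      \<longleftrightarrow> inj_on (half_edge_vert G) (half_edges \<sigma> M)" (is "?L \<longleftrightarrow> ?R")
    if M: "M \<subseteq> Ep \<times> {1..d}" for M
  proof -
    define p q where "p = (\<lambda>(e :: 'a, k :: nat). (e, k, True))" and "q = (\<lambda>(e, k). (e, \<sigma> e k, False))"
    let ?v = "half_edge_vert G"
    have pq: "inj_on p M" "inj_on q M" "p m \<noteq> q m'" "q m \<noteq> p m'" for m m'
      using inj_on_shifted_edges[OF \<sigma> M]
      by (auto simp: p_def q_def inj_on_def split: prod.splits)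
    have "mg_ends (covering_graph d G Ep \<sigma>) m = Upair (?v (p m)) (?v (q m))" for m
      by (cases m) (simp add: covering_graph_def p_def q_def half_edge_vert_def)
    hence "?L \<longleftrightarrow> (\<forall>m\<in>M. ?v (p m) \<noteq> ?v (q m)) \<and> (\<forall>m\<in>M. \<forall>m'\<in>M. m \<noteq> m' \<longrightarrow>
        {?v (p m), ?v (q m)} \<inter> {?v (p m'), ?v (q m')} = {})"
      by simp
    also have "\<dots> \<longleftrightarrow> inj_on ?v (p ` M \<union> q ` M)"
      using pq unfolding inj_on_def ball_Un ball_simps by (auto 0 4)
    also have "p ` M \<union> q ` M = half_edges \<sigma> M"
      by (simp add: half_edges_def p_def q_def)
    finally show ?thesis .
  qed
  have "mg_edges (covering_graph d G Ep \<sigma>) = Ep \<times> {1..d}"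
    by (simp add: covering_graph_def)
  thus ?thesis unfolding matchings_def by (intro Collect_cong conj_cong *) simp_all
qed

text \<open>Expanding, M collects the lifts whose factor contributes the product term instead of
  1.\<close>

lemma prod_one_minus_half_edges:
  fixes w :: "'e \<times> nat \<times> bool \<Rightarrow> complex"
  assumes Ep: "finite Ep" and A: "finite A" and \<sigma>: "\<And>e. e \<in> Ep \<Longrightarrow> inj (\<sigma> e)"
  shows "(\<Prod>e\<in>Ep. \<Prod>k\<in>A. 1 - w (e, k, True) * w (e, \<sigma> e k, False)) =
    (\<Sum>M\<in>Pow (Ep \<times> A). (- 1) ^ card M * (\<Prod>s\<in>half_edges \<sigma> M. w s))"
proof -
  have "(\<Prod>e\<in>Ep. \<Prod>k\<in>A. 1 - w (e, k, True) * w (e, \<sigma> e k, False))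
      = (\<Prod>m\<in>Ep \<times> A. 1 - (case m of (e, k) \<Rightarrow> w (e, k, True) * w (e, \<sigma> e k, False)))"
    by (simp add: prod.cartesian_product case_prod_unfold)
  also have "\<dots> = (\<Sum>M\<in>Pow (Ep \<times> A). (- 1) ^ card M *
      (\<Prod>(e, k)\<in>M. w (e, k, True) * w (e, \<sigma> e k, False)))"
    using Ep A by (subst prod_diff_conv_sum) auto
  also have "\<dots> = (\<Sum>M\<in>Pow (Ep \<times> A). (- 1) ^ card M * (\<Prod>s\<in>half_edges \<sigma> M. w s))"
    using Ep A by (intro sum.cong refl, subst prod_half_edges[OF \<sigma>]) (auto intro: finite_subset)
  finally show ?thesis .
qed

text \<open>Values on \<open>Ep\<close> can be chosen freely and determine those on reversed edges,
  so restriction to \<open>Ep\<close> is a bijection; the hypothesis on g lets the summand follow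
  it.\<close>

lemma sum_coverings:
  fixes G :: "('v, 'e) pre_digraph"
  assumes "bidirected_digraph G arev" and or: "is_orientation G arev Ep"
    and g: "\<And>\<sigma>. g (restrict \<sigma> Ep) = g \<sigma>"
  shows "(\<Sum>\<sigma>\<in>coverings d G arev. g \<sigma>) = (\<Sum>\<sigma>\<in>Ep \<rightarrow>\<^sub>E {p. p permutes {1..d}}. g \<sigma>)"
proof -
  interpret bidirected_digraph G arev by fact
  have Ep: "Ep \<subseteq> arcs G" "Ep \<inter> arev ` Ep = {}" "Ep \<union> arev ` Ep = arcs G"
    using or by (auto simp: is_orientation_def)
  \<comment> \<open>The value \<open>undefined\<close> off the arcs places the extension in the
    extensional function space.\<close>
  define lift where "lift \<tau> = (\<lambda>e. if e \<in> Ep then \<tau> e else if e \<in> arcs G then inv (\<tau> (arev e)) else undefined)"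
    for \<tau> :: "'e \<Rightarrow> nat \<Rightarrow> nat"
  have rev: "arev e \<in> Ep" if "e \<in> arcs G" "e \<notin> Ep" for e using that unfolding Ep(3)[symmetric] by auto
  have rev': "arev e \<notin> Ep" if "e \<in> Ep" for e using that Ep(2) by blast
  show ?thesis
  proof (rule sum.reindex_bij_witness[where S = "coverings d G arev" and T = "Ep \<rightarrow>\<^sub>E {p. p permutes {1..d}}"
        and i = lift and j = "\<lambda>\<sigma>. restrict \<sigma> Ep" and g = g and h = g])
    fix \<sigma> assume \<sigma>: "\<sigma> \<in> coverings d G arev"
    hence PiE: "\<sigma> \<in> arcs G \<rightarrow>\<^sub>E {p. p permutes {1..d}}"
      and inv: "\<And>e. e \<in> arcs G \<Longrightarrow> \<sigma> (arev e) = inv (\<sigma> e)"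
      unfolding coverings_def by blast+
    show "lift (restrict \<sigma> Ep) = \<sigma>"
    proof (rule ext)
      fix e
      consider "e \<in> Ep" | "e \<in> arcs G" "e \<notin> Ep" | "e \<notin> arcs G" by blast
      thus "lift (restrict \<sigma> Ep) e = \<sigma> e"
      proof cases
        case 1
        thus ?thesis by (simp add: lift_def)
      next
        case 2
        \<comment> \<open>The inversion law is used at the reversed edge, which lies in
          \<open>Ep\<close>.\<close>
        have "\<sigma> (arev (arev e)) = inv (\<sigma> (arev e))" using 2 by (intro inv arev_in_arcs)
        thus ?thesis using 2 rev[OF 2] by (simp add: lift_def)
      next
        case 3
        hence "e \<notin> Ep" using Ep(1) by blast
        thus ?thesis using 3 PiE_arb[OF PiE 3] by (simp add: lift_def)
      qed
    qed
    show "restrict \<sigma> Ep \<in> Ep \<rightarrow>\<^sub>E {p. p permutes {1..d}}"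
      using PiE_mem[OF PiE] Ep(1) by (simp add: restrict_PiE_iff subset_iff)
    show "g (restrict \<sigma> Ep) = g \<sigma>" by (rule g)
  next
    fix \<tau> assume \<tau>: "\<tau> \<in> Ep \<rightarrow>\<^sub>E {p. p permutes {1..d}}"
    show "restrict (lift \<tau>) Ep = \<tau>"
      using \<tau> by (auto simp: lift_def fun_eq_iff PiE_def extensional_def)
    have perm: "\<tau> e permutes {1..d}" if "e \<in> Ep" for e using \<tau> that by auto
    have "lift \<tau> (arev e) = inv (lift \<tau> e)" if "e \<in> arcs G" for e
    proof (cases "e \<in> Ep")
      case True
      thus ?thesis using rev' that by (simp add: lift_def)
    next
      case False
      thus ?thesis using rev[OF that False] that perm
        by (simp add: lift_def permutes_inv_inv[OF perm])
    qed
    moreover have "inv (\<tau> (arev e)) permutes {1..d}" if "e \<in> arcs G" "e \<notin> Ep" for e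
      using rev[OF that] by (intro permutes_inv perm)
    ultimately show "lift \<tau> \<in> coverings d G arev"
      using perm Ep(1) unfolding coverings_def by (auto simp: lift_def)
  qed
qed

text \<open>The Lieb-Sokal argument is applied to all pairs of a covering and a set of lifts; sets
  that are not matchings contribute 0.\<close>

lemma sum_matchings_nonzero:
  fixes G :: "('v, 'e) pre_digraph"
  assumes "wf_digraph G" and V: "finite (verts G)" and Ep: "finite Ep" "Ep \<subseteq> arcs G"
    and y: "\<And>u. u \<in> verts G \<times> {1..d} \<Longrightarrow> Im (y u) > 0"
  shows "(\<Sum>\<sigma>\<in>Ep \<rightarrow>\<^sub>E {p. p permutes {1..d}}. \<Sum>M\<in>matchings (covering_graph d G Ep \<sigma>).
       (- 1) ^ card M * (\<Prod>u\<in>verts G \<times> {1..d} - covered_verts (covering_graph d G Ep \<sigma>) M. y u)) \<noteq> 0"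
proof -
  interpret wf_digraph G by fact
  define P where "P = (Ep \<rightarrow>\<^sub>E {p. p permutes {1..d}})"
  define E where "E = Ep \<times> {1..d}"
  have inj: "inj (\<sigma> e)" and perm: "\<sigma> e permutes {1..d}" if "\<sigma> \<in> P" "e \<in> Ep" for \<sigma> e
    using that by (auto simp: P_def intro: permutes_inj)
  have finE: "finite E" using Ep by (simp add: E_def)
  define V' where "V' = verts G \<times> {1..d}"
  define W where "W = Ep \<times> {1..d} \<times> (UNIV :: bool set)"
  have "(\<Sum>(\<sigma>, M)\<in>P \<times> Pow E. (- 1) ^ card M * (if inj_on (half_edge_vert G) (half_edges \<sigma> M)
      then (- 1) ^ card (half_edges \<sigma> M) * (\<Prod>u\<in>V' - half_edge_vert G ` half_edges \<sigma> M. y u)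
      else 0)) \<noteq> 0"
    unfolding case_prod_unfold
  proof (rule lieb_sokal_sum[where W = W])
    show "finite V'" "finite W" using V Ep by (auto simp: V'_def W_def)
    show "half_edge_vert G ` W \<subseteq> V'"
      using Ep by (auto simp: V'_def W_def half_edge_vert_def)
    show "half_edges (fst i) (snd i) \<subseteq> W" if "i \<in> P \<times> Pow E" for i
    proof -
      obtain \<sigma> M where i: "i = (\<sigma>, M)" "\<sigma> \<in> P" "M \<subseteq> E" using \<open>i \<in> P \<times> Pow E\<close> by auto
      have "\<sigma> e k \<in> {1..d}" if "(e, k) \<in> M" for e k
        using perm[OF i(2), of e] that i(3) permutes_in_image[of "\<sigma> e" "{1..d}" k]
        by (auto simp: E_def)
      thus ?thesis using i by (auto simp: half_edges_def W_def E_def)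
    qed
    show "Im (y u) > 0" if "u \<in> V'" for u using y that by (simp add: V'_def)
    fix w :: "'e \<times> nat \<times> bool \<Rightarrow> complex" assume w: "\<And>s. w s \<in> uhp0"
    \<comment> \<open>Independence of the permutations makes the auxiliary sum a product over edges,
      each factor being a nonzero permutation sum.\<close>
    have "(\<Prod>e\<in>Ep. \<Sum>p | p permutes {1..d}. \<Prod>k\<in>{1..d}. 1 - w (e, k, True) * w (e, p k, False)) \<noteq> 0"
      using Ep w sum_permutations_prod_nonzero[of "{1..d}" "\<lambda>k. w (e, k, True)" "\<lambda>k. w (e, k, False)" for e]
      by simp
    also have "(\<Prod>e\<in>Ep. \<Sum>p | p permutes {1..d}. \<Prod>k\<in>{1..d}. 1 - w (e, k, True) * w (e, p k, False))
        = (\<Sum>\<sigma>\<in>P. \<Prod>e\<in>Ep. \<Prod>k\<in>{1..d}. 1 - w (e, k, True) * w (e, \<sigma> e k, False))"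
      unfolding P_def using Ep by (intro prod_sum_PiE) (auto simp: finite_permutations)
    also have "\<dots> = (\<Sum>\<sigma>\<in>P. \<Sum>M\<in>Pow E. (- 1) ^ card M * (\<Prod>s\<in>half_edges \<sigma> M. w s))"
      unfolding E_def using Ep inj by (intro sum.cong refl prod_one_minus_half_edges) auto
    finally show "(\<Sum>i\<in>P \<times> Pow E. (- 1) ^ card (snd i) * (\<Prod>s\<in>half_edges (fst i) (snd i). w s)) \<noteq> 0"
      by (simp add: sum.cartesian_product case_prod_unfold)
  qed
  also have "(\<Sum>(\<sigma>, M)\<in>P \<times> Pow E. (- 1) ^ card M * (if inj_on (half_edge_vert G) (half_edges \<sigma> M)
      then (- 1) ^ card (half_edges \<sigma> M) * (\<Prod>u\<in>V' - half_edge_vert G ` half_edges \<sigma> M. y u)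
      else 0)) =
    (\<Sum>\<sigma>\<in>P. \<Sum>M\<in>Pow E. if inj_on (half_edge_vert G) (half_edges \<sigma> M)
      then (- 1) ^ card M * (\<Prod>u\<in>V' - half_edge_vert G ` half_edges \<sigma> M. y u) else 0)"
    unfolding sum.cartesian_product[symmetric]
  proof (intro sum.cong refl)
    fix \<sigma> M assume "\<sigma> \<in> P" "M \<in> Pow E"
    hence "card (half_edges \<sigma> M) = 2 * card M"
      using finE inj by (intro card_half_edges[of Ep _ _ "{1..d}"]) (auto simp: E_def intro: finite_subset)
    thus "(- 1) ^ card M * (if inj_on (half_edge_vert G) (half_edges \<sigma> M)
        then (- 1) ^ card (half_edges \<sigma> M) * (\<Prod>u\<in>V' - half_edge_vert G ` half_edges \<sigma> M. y u)
        else 0) =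
      (if inj_on (half_edge_vert G) (half_edges \<sigma> M)
        then (- 1) ^ card M * (\<Prod>u\<in>V' - half_edge_vert G ` half_edges \<sigma> M. y u) else 0)"
      by simp
  qed
  also have "\<dots> = (\<Sum>\<sigma>\<in>P. \<Sum>M\<in>matchings (covering_graph d G Ep \<sigma>).
      (- 1) ^ card M * (\<Prod>u\<in>V' - covered_verts (covering_graph d G Ep \<sigma>) M. y u))"
  proof (rule sum.cong[OF refl])
    fix \<sigma> assume \<sigma>: "\<sigma> \<in> P"
    have eq: "matchings (covering_graph d G Ep \<sigma>)
        = {M \<in> Pow E. inj_on (half_edge_vert G) (half_edges \<sigma> M)}"
      using matchings_covering_graph[of Ep \<sigma> d G] inj[OF \<sigma>] by (auto simp: E_def)
    show "(\<Sum>M\<in>Pow E. if inj_on (half_edge_vert G) (half_edges \<sigma> M)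
        then (- 1) ^ card M * (\<Prod>u\<in>V' - half_edge_vert G ` half_edges \<sigma> M. y u) else 0) =
      (\<Sum>M\<in>matchings (covering_graph d G Ep \<sigma>).
        (- 1) ^ card M * (\<Prod>u\<in>V' - covered_verts (covering_graph d G Ep \<sigma>) M. y u))"
      unfolding eq covered_verts_covering_graph
      by (rule sum.inter_filter[symmetric]) (simp add: finE)
  qed
  finally show ?thesis by (simp add: P_def V'_def)
qed


text \<open>The two graphs can differ as records, since \<open>mg_ends\<close> also has values off
  the edge set. Agreement on edges suffices for matchings and covered vertices.\<close>

lemma mg_ends_covering_graph_restrict:
  "m \<in> mg_edges (covering_graph d G Ep \<sigma>) \<Longrightarrow>
   mg_ends (covering_graph d G Ep (restrict \<sigma> Ep)) m = mg_ends (covering_graph d G Ep \<sigma>) m"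
  by (auto simp: covering_graph_def)

lemma matchings_covering_graph_restrict:
  "matchings (covering_graph d G Ep (restrict \<sigma> Ep)) = matchings (covering_graph d G Ep \<sigma>)"
proof -
  have "mg_edges (covering_graph d G Ep (restrict \<sigma> Ep)) = mg_edges (covering_graph d G Ep \<sigma>)"
    by (simp add: covering_graph_def)
  thus ?thesis unfolding matchings_def
    by (intro Collect_cong conj_cong ball_cong)
      (simp_all add: mg_ends_covering_graph_restrict subset_eq)
qed

lemma covered_verts_covering_graph_restrict:
  assumes "M \<in> matchings (covering_graph d G Ep \<sigma>)"
  shows "covered_verts (covering_graph d G Ep (restrict \<sigma> Ep)) M
    = covered_verts (covering_graph d G Ep \<sigma>) M"
  unfolding covered_verts_def using assms
  by (intro SUP_cong refl) (auto simp: matchings_def mg_ends_covering_graph_restrict subset_eq)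

theorem theorem3p7:
  fixes n d :: nat
    and G :: "(nat, 'e) pre_digraph"
    and arev :: "'e \<Rightarrow> 'e"
    and Ep :: "'e set"
  assumes "fin_digraph G"
    and "bidirected_digraph G arev"
    and "verts G = {1..n}"
    and "is_orientation G arev Ep"
    and "d \<ge> 1"
  shows "poly_vars (d_matching_poly d G arev Ep) \<subseteq> {1..n} \<times> {1..d} \<and>
         stable_poly ({1..n} \<times> {1..d}) (d_matching_poly d G arev Ep)"
proof
  interpret fin_digraph G by fact
  have V: "finite (verts G)" by simp
  have Ep: "Ep \<subseteq> arcs G" using assms(4) by (auto simp: is_orientation_def)
  hence finEp: "finite Ep" by (rule finite_subset) simp
  show "poly_vars (d_matching_poly d G arev Ep) \<subseteq> {1..n} \<times> {1..d}"
    using poly_vars_d_matching_poly[OF V] assms(3) by simp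
  show "stable_poly ({1..n} \<times> {1..d}) (d_matching_poly d G arev Ep)"
    unfolding stable_poly_def
  proof (intro disjI2 allI impI)
    fix y :: "nat \<times> nat \<Rightarrow> complex"
    assume y: "\<forall>j\<in>{1..n} \<times> {1..d}. Im (y j) > 0"
    define g where "g \<sigma> = (\<Sum>M\<in>matchings (covering_graph d G Ep \<sigma>). (- 1) ^ card M *
      (\<Prod>u\<in>verts G \<times> {1..d} - covered_verts (covering_graph d G Ep \<sigma>) M. y u))" for \<sigma>
    have "(\<Sum>\<sigma>\<in>coverings d G arev. g \<sigma>) = (\<Sum>\<sigma>\<in>Ep \<rightarrow>\<^sub>E {p. p permutes {1..d}}. g \<sigma>)"
    proof (rule sum_coverings[OF assms(2,4)])
      fix \<sigma> :: "'e \<Rightarrow> nat \<Rightarrow> nat"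
      show "g (restrict \<sigma> Ep) = g \<sigma>"
        unfolding g_def
        by (intro sum.cong matchings_covering_graph_restrict)
          (simp add: covered_verts_covering_graph_restrict)
    qed
    also have "\<dots> \<noteq> 0"
      unfolding g_def using V finEp Ep y assms(3)
      by (intro sum_matchings_nonzero wf_digraph_axioms) auto
    finally have nz: "(\<Sum>\<sigma>\<in>coverings d G arev. g \<sigma>) \<noteq> 0" .
    \<comment> \<open>A sum over an empty or infinite set is 0, so the nonzero sum also shows that
      the normalising factor is not the default 1 / 0 = 0.\<close>
    hence "card (coverings d G arev) \<noteq> 0"
      by (metis card_eq_0_iff sum.empty sum.infinite)
    with nz show "eval_poly (d_matching_poly d G arev Ep) y \<noteq> 0"
      by (simp add: eval_d_matching_poly[OF V] g_def)
  qed
qed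

end
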